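(* Let $G$ be a finite simple connected graph with maximum degree $\Delta(G)=4$. Suppose that $G$ contains six distinct vertices $x,y,z,u,v,w$ such that $xy,\,xz,\,yz,\,xu,\,yu,\,uv,\,vw\in E(G)$, with $d_G(x)=d_G(z)=d_G(w)=3$ and $d_G(y)=d_G(u)=d_G(v)=4$. Let $e=xy$. If $\chi'(G-e)=4$, then $\chi'(G)=4$.
   Context: $d_G(a)$ denotes the degree of the vertex $a$ in $G$. $\chi'(G)$ denotes the chromatic index, the least $k$ such that $G$ has a proper $k$-edge-coloring. $G-e$ is the graph obtained from $G$ by deleting the edge $e$ (keeping all vertices). The listed edges are required to be present; further edges of $G$ among the listed vertices are allowed subject to the degree conditions (the configuration is not required to be induced). *)

theory Defs
  imports Main
begin

text \<open>A graph is given by its vertex set \<open>V\<close> and its edge set \<open>E\<close>; an edge is a two-element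
  set of vertices, so that loops and parallel edges do not arise.\<close>

definition finite_simple_graph :: "'a set \<Rightarrow> 'a set set \<Rightarrow> bool" where
  "finite_simple_graph V E \<longleftrightarrow> finite V \<and> (\<forall>e\<in>E. e \<subseteq> V \<and> card e = 2)"

definition connected_graph :: "'a set \<Rightarrow> 'a set set \<Rightarrow> bool" where
  "connected_graph V E \<longleftrightarrow>
     V \<noteq> {} \<and> (\<forall>a\<in>V. \<forall>b\<in>V. (a, b) \<in> {(p, q). {p, q} \<in> E}\<^sup>*)"

definition degree :: "'a set set \<Rightarrow> 'a \<Rightarrow> nat" where
  "degree E a = card {e \<in> E. a \<in> e}"

definition max_degree :: "'a set \<Rightarrow> 'a set set \<Rightarrow> nat" where
  "max_degree V E = Max (degree E ` V)"

definition proper_edge_coloring :: "'a set set \<Rightarrow> nat \<Rightarrow> ('a set \<Rightarrow> nat) \<Rightarrow> bool" where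
  "proper_edge_coloring E k c \<longleftrightarrow>
     (\<forall>e\<in>E. c e < k) \<and> (\<forall>e\<in>E. \<forall>f\<in>E. e \<noteq> f \<and> e \<inter> f \<noteq> {} \<longrightarrow> c e \<noteq> c f)"

definition chromatic_index :: "'a set set \<Rightarrow> nat" where
  "chromatic_index E = (LEAST k. \<exists>c. proper_edge_coloring E k c)"

text \<open>For a finite edge set the minimum in the definition of the chromatic index is attained.\<close>

lemma chromatic_index_attained:
  assumes "finite E"
  shows "\<exists>c. proper_edge_coloring E (chromatic_index E) c"
proof -
  obtain c :: "'a set \<Rightarrow> nat" where "bij_betw c E {0..<card E}"
    using ex_bij_betw_finite_nat[OF assms] by blast
  then have "proper_edge_coloring E (card E) c"
    by (auto simp: proper_edge_coloring_def bij_betw_def dest: inj_onD)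
  then have "\<exists>k c. proper_edge_coloring E k c" by blast
  then show ?thesis
    unfolding chromatic_index_def by (rule LeastI_ex)
qed

end

theory Submission
  imports Defs "HOL-Combinatorics.Transposition"
begin

text \<open>Let \<open>K = {x, y, z, u}\<close>. Exactly four edges leave the five coloured edges inside \<open>K\<close>: one at
  \<open>y\<close>, one at \<open>z\<close> and two at \<open>u\<close>, one of which is \<open>uv\<close>. A 4-colouring of the remaining edges
  that is proper outside \<open>K\<close> and at \<open>u\<close> extends to the edges inside \<open>K\<close> unless the four outgoing
  edges have four different colours. In the latter case swap colours along Kempe chains (cut off at
  \<open>K\<close>) that start at the vertex \<open>w\<close>, which misses a colour. Such a chain is a path with \<open>w\<close> as one
  end, so it contains at most one outgoing edge; if it contains one, the swap creates a repetition
  among the outgoing colours. Otherwise the outgoing colours stay as they are while the missing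
  colour of \<open>w\<close> can be chosen freely enough to force a chain through \<open>vw\<close> and \<open>uv\<close>. The only
  forbidden swap is that of the two colours leaving \<open>u\<close>.\<close>

section \<open>Colourings that are proper away from a vertex set\<close>

text \<open>Conflicts at \<open>K\<close> are ignored because the inner edges are recoloured at the
  end. This also cuts the chains: an edge that meets \<open>K\<close> continues a chain through at
  most one of its ends.\<close>

definition proper_outside :: "'a set set \<Rightarrow> 'a set \<Rightarrow> nat \<Rightarrow> ('a set \<Rightarrow> nat) \<Rightarrow> bool" where
  "proper_outside F K k c \<longleftrightarrow>
     (\<forall>e\<in>F. c e < k) \<and> (\<forall>e\<in>F. \<forall>f\<in>F. e \<noteq> f \<and> e \<inter> f - K \<noteq> {} \<longrightarrow> c e \<noteq> c f)"

lemma proper_outside_less: "proper_outside F K k c \<Longrightarrow> e \<in> F \<Longrightarrow> c e < k"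
  by (simp add: proper_outside_def)

lemma proper_outside_neq:
  "proper_outside F K k c \<Longrightarrow> e \<in> F \<Longrightarrow> f \<in> F \<Longrightarrow> e \<noteq> f \<Longrightarrow> p \<in> e \<Longrightarrow> p \<in> f \<Longrightarrow> p \<notin> K
    \<Longrightarrow> c e \<noteq> c f"
  unfolding proper_outside_def by blast

lemma proper_edge_coloring_neq:
  "proper_edge_coloring E k c \<Longrightarrow> e \<in> E \<Longrightarrow> f \<in> E \<Longrightarrow> e \<noteq> f \<Longrightarrow> e \<inter> f \<noteq> {} \<Longrightarrow> c e \<noteq> c f"
  by (simp add: proper_edge_coloring_def)

lemma proper_edge_coloring_subset:
  "proper_edge_coloring E k c \<Longrightarrow> F \<subseteq> E \<Longrightarrow> proper_edge_coloring F k c"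
  by (simp add: proper_edge_coloring_def subset_iff)

lemma proper_outside_if_proper:
  assumes "proper_edge_coloring F k c"
  shows "proper_outside F K k c"
proof -
  have "c e < k" if "e \<in> F" for e using assms that by (simp add: proper_edge_coloring_def)
  moreover have "c e \<noteq> c f" if "e \<in> F" "f \<in> F" "e \<noteq> f" "e \<inter> f - K \<noteq> {}" for e f
    using proper_edge_coloring_neq[OF assms that(1-3)] that(4) by blast
  ultimately show ?thesis by (simp add: proper_outside_def)
qed

section \<open>Kempe chains\<close>

text \<open>\<open>R\<close> has degree at most 2, and at most 1 at \<open>a\<close>, so the
  component of \<open>a\<close> is a path starting there. An element with \<open>S\<close> has
  degree at most 1 and can only be the far end; \<open>a\<close> itself qualifies only when
  isolated. In the application the elements are edges and \<open>S\<close> means meeting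
  \<open>K\<close>.\<close>

lemma path_component:
  fixes R :: "'b \<Rightarrow> 'b \<Rightarrow> bool"
  assumes "finite A" and "a \<in> A"
    and RA: "\<And>g h. R g h \<Longrightarrow> h \<in> A" and sym: "\<And>g h. R g h \<Longrightarrow> R h g"
    and deg2: "\<And>h g1 g2 g3. R h g1 \<Longrightarrow> R h g2 \<Longrightarrow> R h g3 \<Longrightarrow> g1 = g2 \<or> g1 = g3 \<or> g2 = g3"
    and start: "\<And>g1 g2. R a g1 \<Longrightarrow> R a g2 \<Longrightarrow> g1 = g2"
    and S: "\<And>h g1 g2. S h \<Longrightarrow> R h g1 \<Longrightarrow> R h g2 \<Longrightarrow> g1 = g2"
    and Sa: "\<And>g. S a \<Longrightarrow> \<not> R a g"
  shows "\<exists>T h. a \<in> T \<and> T \<subseteq> A \<and> (\<forall>g\<in>T. \<forall>g'. R g g' \<longrightarrow> g' \<in> T) \<and> (\<forall>g\<in>T. S g \<longrightarrow> g = h)"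
proof -
  \<comment> \<open>\<open>T\<close> is an initial segment of the path from \<open>a\<close>, and \<open>h\<close> is its last element.\<close>
  define I where "I T \<longleftrightarrow> a \<in> T \<and> T \<subseteq> A \<and> (\<exists>h\<in>T. (h = a \<or> (\<exists>g\<in>T. R h g)) \<and>
      (\<forall>g\<in>T. g \<noteq> h \<longrightarrow> \<not> S g \<and> (\<forall>g'. R g g' \<longrightarrow> g' \<in> T)))" for T
  have "I {a}" using \<open>a \<in> A\<close> by (auto simp: I_def)
  moreover have "card T < Suc (card A)" if "I T" for T
    using that \<open>finite A\<close> by (auto simp: I_def less_Suc_eq_le intro: card_mono)
  ultimately obtain T where T: "I T" and mx: "\<And>T'. I T' \<Longrightarrow> card T' \<le> card T"
    using ex_has_greatest_nat[of I "{a}" card "Suc (card A)"] by (metis less_imp_le)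
  then have aT: "a \<in> T" and TA: "T \<subseteq> A" by (auto simp: I_def)
  from T obtain h where h: "h \<in> T" "h = a \<or> (\<exists>g\<in>T. R h g)"
    and cl: "\<And>g. g \<in> T \<Longrightarrow> g \<noteq> h \<Longrightarrow> \<not> S g \<and> (\<forall>g'. R g g' \<longrightarrow> g' \<in> T)"
    by (auto simp: I_def)
  \<comment> \<open>A neighbour \<open>g\<close> outside \<open>T\<close> would become the new last
    element, against maximality. If \<open>h\<close> is not \<open>a\<close>, it already has a
    neighbour in \<open>T\<close>, which rules out \<open>S h\<close> and any third
    neighbour.\<close>
  have "g \<in> T" if "R h g" for g
  proof (rule ccontr)
    assume g: "g \<notin> T"
    have "\<not> S h"
      using h(2) S[of h _ g] Sa[of g] \<open>R h g\<close> g by metis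
    moreover have "g' \<in> insert g T" if "R h g'" for g'
      using h(2) start[of g g'] deg2[of h g g'] \<open>R h g\<close> \<open>R h g'\<close> g by (metis insertCI)
    ultimately have "I (insert g T)"
      unfolding I_def using aT TA RA[OF \<open>R h g\<close>] sym[OF \<open>R h g\<close>] h(1) cl
      by (intro conjI bexI[of _ g]) auto
    moreover have "finite T" using TA \<open>finite A\<close> by (rule finite_subset)
    ultimately show False using mx[of "insert g T"] g by simp
  qed
  then have "g' \<in> T" if "g \<in> T" "R g g'" for g g' using cl that by metis
  moreover have "g = h" if "g \<in> T" "S g" for g using cl that by metis
  ultimately show ?thesis using aT TA by (intro exI[of _ T] exI[of _ h]) simp
qed

text \<open>As \<open>w\<close> misses \<open>a\<close>, the chain of its \<open>b\<close>-edge is a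
  path that begins at \<open>w\<close>. Edges meeting \<open>K\<close> can only be its far end,
  hence the single edge \<open>h\<close>.\<close>

lemma kempe_swap:
  assumes "finite F" and two: "\<forall>e\<in>F. card e = 2"
    and c: "proper_outside F K k c" and "a < k" and "b < k" and "w \<notin> K"
    and w: "\<forall>e\<in>F. w \<in> e \<longrightarrow> c e \<noteq> a"
  shows "\<exists>T h. proper_outside F K k (\<lambda>e. if e \<in> T then transpose a b (c e) else c e) \<and>
    (\<forall>e\<in>T. c e \<in> {a, b} \<and> (e \<inter> K \<noteq> {} \<longrightarrow> e = h)) \<and> (\<forall>e\<in>F. w \<in> e \<and> c e = b \<longrightarrow> e \<in> T)"
proof -
  define A where "A = {e \<in> F. c e \<in> {a, b}}"
  define R where "R e f \<longleftrightarrow> e \<in> A \<and> f \<in> A \<and> e \<noteq> f \<and> e \<inter> f - K \<noteq> {}" for e f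
  have R_at: "g1 = g2" if "R e g1" "R e g2" "p \<in> e" "p \<in> g1" "p \<in> g2" "p \<notin> K" for e g1 g2 p
    using that proper_outside_neq[OF c, of _ _ p] unfolding R_def A_def
    by (smt (verit) insertE mem_Collect_eq singletonD)
  \<comment> \<open>Two chain edges at \<open>w\<close> would both have colour \<open>b\<close>, so
    no chain passes through \<open>w\<close>.\<close>
  have w_edge: "p \<noteq> w" if "R e g" "w \<in> e" "p \<in> e" "p \<in> g" "p \<notin> K" for e g p
    using that w proper_outside_neq[OF c, of e g p] unfolding R_def A_def by fastforce
  have R_E: "\<exists>p. p \<in> e \<and> p \<in> g \<and> p \<notin> K" if "R e g" for e g
    using that by (auto simp: R_def)
  have pair: "\<exists>p q. e = {p, q}" if "R e g" for e g
    using that two by (auto simp: R_def A_def card_2_iff)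
  have "\<exists>T h. T \<subseteq> A \<and> (\<forall>g\<in>T. \<forall>g'. R g g' \<longrightarrow> g' \<in> T) \<and> (\<forall>g\<in>T. g \<inter> K \<noteq> {} \<longrightarrow> g = h)
      \<and> (\<forall>e\<in>F. w \<in> e \<and> c e = b \<longrightarrow> e \<in> T)"
  proof (cases "\<exists>e\<in>F. w \<in> e \<and> c e = b")
    case False
    \<comment> \<open>If \<open>w\<close> misses \<open>b\<close> as well, the empty swap
      suffices.\<close>
    then show ?thesis by (intro exI[of _ "{}"]) auto
  next
    case True
    then obtain e where e: "e \<in> F" "w \<in> e" "c e = b" by blast
    have fin: "finite A" using \<open>finite F\<close> by (simp add: A_def)
    have eA: "e \<in> A" using e by (simp add: A_def)
    have deg2: "g1 = g2 \<or> g1 = g3 \<or> g2 = g3" if R: "R h g1" "R h g2" "R h g3" for h g1 g2 g3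
    proof -
      obtain p q where "h = {p, q}" using pair[OF R(1)] by blast
      then show ?thesis
        using R_E[OF R(1)] R_E[OF R(2)] R_E[OF R(3)] R_at[OF R(1,2)]
          R_at[OF R(1,3)] R_at[OF R(2,3)] by auto
    qed
    have start: "g1 = g2" if R: "R e g1" "R e g2" for g1 g2
    proof -
      obtain p q where "e = {p, q}" using pair[OF R(1)] by blast
      then show ?thesis
        using R_E[OF R(1)] R_E[OF R(2)] R_at[OF R(1,2)] \<open>w \<in> e\<close>
          w_edge[OF R(1)] w_edge[OF R(2)] by auto
    qed
    have S: "g1 = g2" if "h \<inter> K \<noteq> {}" and R: "R h g1" "R h g2" for h g1 g2
    proof -
      obtain p q where "h = {p, q}" using pair[OF R(1)] by blast
      then show ?thesis
        using R_E[OF R(1)] R_E[OF R(2)] R_at[OF R] \<open>h \<inter> K \<noteq> {}\<close> by auto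
    qed
    \<comment> \<open>Here the other end of \<open>e\<close> lies in \<open>K\<close>, so the chain
      consists of \<open>e\<close> alone.\<close>
    have Se: "\<not> R e g" if "e \<inter> K \<noteq> {}" for g
    proof
      assume "R e g"
      then obtain p q where "e = {p, q}" using pair by blast
      then show False
        using R_E[OF \<open>R e g\<close>] that \<open>w \<in> e\<close> \<open>w \<notin> K\<close> w_edge[OF \<open>R e g\<close>] by auto
    qed
    have RA: "\<And>g h. R g h \<Longrightarrow> h \<in> A" and sym: "\<And>g h. R g h \<Longrightarrow> R h g" by (auto simp: R_def)
    have "\<exists>T h. e \<in> T \<and> T \<subseteq> A \<and> (\<forall>g\<in>T. \<forall>g'. R g g' \<longrightarrow> g' \<in> T)
        \<and> (\<forall>g\<in>T. g \<inter> K \<noteq> {} \<longrightarrow> g = h)"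
      by (rule path_component[where S = "\<lambda>g. g \<inter> K \<noteq> {}", OF fin eA])
        (rule RA sym deg2 start S Se; assumption)+
    moreover have "f = e" if "f \<in> F" "w \<in> f" "c f = b" for f
      using proper_outside_neq[OF c that(1) e(1) _ that(2) e(2) \<open>w \<notin> K\<close>] that(3) e(3) by metis
    ultimately obtain T h where T: "T \<subseteq> A" "\<forall>g\<in>T. \<forall>g'. R g g' \<longrightarrow> g' \<in> T"
        "\<forall>g\<in>T. g \<inter> K \<noteq> {} \<longrightarrow> g = h"
      and "\<forall>f\<in>F. w \<in> f \<and> c f = b \<longrightarrow> f \<in> T" by (elim exE) auto
    then show ?thesis by (intro exI[of _ T] exI[of _ h] conjI)
  qed
  then obtain T h where TA: "T \<subseteq> A" and cl: "\<forall>g\<in>T. \<forall>g'. R g g' \<longrightarrow> g' \<in> T"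
    and Th: "\<forall>g\<in>T. g \<inter> K \<noteq> {} \<longrightarrow> g = h" and Tw: "\<forall>e\<in>F. w \<in> e \<and> c e = b \<longrightarrow> e \<in> T"
    by (elim exE conjE)
  define c' where "c' = (\<lambda>e. if e \<in> T then transpose a b (c e) else c e)"
  have Tab: "c e \<in> {a, b}" if "e \<in> T" for e using that TA by (auto simp: A_def)
  \<comment> \<open>Closure of \<open>T\<close> under \<open>R\<close> keeps \<open>a\<close> and
    \<open>b\<close> off such an \<open>f\<close>, while the swapped colour of \<open>e\<close>
    remains one of them.\<close>
  have mixed: "c' e \<noteq> c' f" if "e \<in> T" "f \<in> F" "f \<notin> T" "e \<inter> f - K \<noteq> {}" for e f
  proof -
    have "\<not> R e f" using cl that by blast
    then have "c f \<notin> {a, b}" using that TA by (auto simp: R_def A_def)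
    then show ?thesis using Tab[OF that(1)] that by (auto simp: c'_def)
  qed
  have "c' e \<noteq> c' f" if "e \<in> F" "f \<in> F" "e \<noteq> f" "e \<inter> f - K \<noteq> {}" for e f
  proof (cases "e \<in> T \<longleftrightarrow> f \<in> T")
    case True
    moreover have "c e \<noteq> c f" using that c unfolding proper_outside_def by blast
    ultimately show ?thesis by (auto simp: c'_def dest: transpose_eq_imp_eq)
  next
    case False
    then show ?thesis using mixed[of e f] mixed[of f e] that by (metis Int_commute)
  qed
  moreover have "c' e < k" if "e \<in> F" for e
    using proper_outside_less[OF c that] \<open>a < k\<close> \<open>b < k\<close> by (auto simp: c'_def transpose_def)
  ultimately have "proper_outside F K k c'" by (simp add: proper_outside_def)
  then show ?thesis using Tab Th Tw unfolding c'_def by (intro exI[of _ T] exI[of _ h]) simp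
qed

section \<open>The configuration inside \<open>{x, y, z, u}\<close>\<close>

text \<open>Here \<open>t\<close>, \<open>m\<close> are the outgoing colours at \<open>y\<close>,
  \<open>z\<close>, and \<open>c3\<close>, \<open>c4\<close> those at \<open>u\<close>. The edges
  \<open>xu\<close>, \<open>yu\<close> must use the other two colours \<open>q\<close>,
  \<open>s\<close>; the cases depend on whether \<open>t\<close> is one of these.\<close>

lemma inner_colours:
  assumes "t < 4" "m < 4" "c3 < 4" "c4 < 4" "c3 \<noteq> c4" and nd: "\<not> distinct [m, t, c3, c4]"
  obtains xy' xz' yz' xu yu :: nat where "xy' < 4" "xz' < 4" "yz' < 4" "xu < 4" "yu < 4"
    "distinct [xy', xz', xu]" "distinct [xy', yz', yu, t]" "distinct [xz', yz', m]"
    "distinct [xu, yu, c3, c4]"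
proof -
  have "card ({..<4} - {c3, c4}) = card {..<4::nat} - card {c3, c4}"
    using \<open>c3 < 4\<close> \<open>c4 < 4\<close> by (intro card_Diff_subset) auto
  then have "card ({..<4} - {c3, c4}) = 2" using \<open>c3 \<noteq> c4\<close> by simp
  then obtain q s where qs: "{..<4} - {c3, c4} = {q, s}" "q \<noteq> s" by (auto simp: card_2_iff)
  have "q \<in> {..<4} - {c3, c4}" "s \<in> {..<4} - {c3, c4}" unfolding qs by simp_all
  then have less: "q < 4" "s < 4" and d: "distinct [q, s, c3, c4]"
    using \<open>q \<noteq> s\<close> \<open>c3 \<noteq> c4\<close> by simp_all
  have cover: "r = q \<or> r = s \<or> r = c3 \<or> r = c4" if "r < 4" for r using qs(1) that by blast
  show ?thesis
  proof (cases "t \<in> {c3, c4}")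
    case True
    then obtain r where r: "{t, r} = {c3, c4}" "t \<noteq> r" "r < 4" "distinct [q, s, t, r]"
    proof (cases "t = c3")
      case True
      then show ?thesis using that[of c4] assms(4,5) d by simp
    next
      case False
      then show ?thesis using that[of c3] \<open>t \<in> {c3, c4}\<close> assms(3,5) d by (simp add: insert_commute)
    qed
    \<comment> \<open>With \<open>t\<close> among the colours leaving \<open>u\<close>,
      \<open>xy\<close> must get \<open>r\<close>, and \<open>yz\<close> the colour of
      \<open>xu\<close>. The order of \<open>q\<close>, \<open>s\<close> on \<open>xu\<close>,
      \<open>yu\<close> is free and is chosen to avoid \<open>m\<close> at \<open>z\<close>.\<close>
    have nd': "distinct [a, b, c3, c4] = distinct [a, b, t, r]" for a b
      using r(1,2) \<open>c3 \<noteq> c4\<close> by (auto simp: doubleton_eq_iff)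
    consider "m = q" | "m = s" | "m = t \<or> m = r" using cover[OF \<open>m < 4\<close>] r(1) by blast
    then show ?thesis
    proof cases
      case 1
      show ?thesis by (rule that[of r t s s q]) (use 1 r(2-4) less \<open>t < 4\<close> nd' in auto)
    next
      case 2
      show ?thesis by (rule that[of r t q q s]) (use 2 r(2-4) less \<open>t < 4\<close> nd' in auto)
    next
      case 3
      show ?thesis by (rule that[of r q s s q]) (use 3 r(2-4) less \<open>t < 4\<close> nd' in auto)
    qed
  next
    case False
    then have "t = q \<or> t = s" using cover[OF \<open>t < 4\<close>] by blast
    \<comment> \<open>Now \<open>xu\<close> must get \<open>t\<close>, and \<open>yu\<close> and
      \<open>xz\<close> must get \<open>s'\<close>; the only obstruction would be
      \<open>m = s'\<close>, excluded by \<open>nd\<close>. \<open>xy\<close> and \<open>yz\<close>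
      share \<open>c3\<close>, \<open>c4\<close>.\<close>
    then obtain s' where qs': "s' < 4" "distinct [t, s', c3, c4]"
      using less d by fastforce
    consider "m = c3" | "m = t \<or> m = c4" using nd False \<open>c3 \<noteq> c4\<close> by auto
    then show ?thesis
    proof cases
      case 1
      show ?thesis
        by (rule that[of c3 s' c4 t s']) (use 1 qs' \<open>t < 4\<close> \<open>c3 < 4\<close> \<open>c4 < 4\<close> in auto)
    next
      case 2
      show ?thesis
        by (rule that[of c4 s' c3 t s']) (use 2 qs' \<open>t < 4\<close> \<open>c3 < 4\<close> \<open>c4 < 4\<close> in auto)
    qed
  qed
qed

text \<open>Outgoing edges need not be distinct: if \<open>z\<close> and \<open>u\<close> are
  adjacent, \<open>sz\<close> coincides with \<open>sv\<close> or \<open>su\<close>. Their colours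
  then repeat, so \<open>extend\<close> covers this case.\<close>

locale triangle_pair =
  fixes E :: "'a set set" and x y z u :: 'a and sy sz sv su :: "'a set"
  assumes fin: "finite E" and two: "\<And>e. e \<in> E \<Longrightarrow> card e = 2"
    and dist: "distinct [x, y, z, u]"
    and Ex: "{e \<in> E. x \<in> e} = {{x, y}, {x, z}, {x, u}}"
    and Ey: "{e \<in> E. y \<in> e} = {{x, y}, {y, z}, {y, u}, sy}"
    and Ez: "{e \<in> E. z \<in> e} = {{x, z}, {y, z}, sz}"
    and Eu: "{e \<in> E. u \<in> e} = {{x, u}, {y, u}, sv, su}"
    and outer: "\<forall>s\<in>{sy, sz, sv, su}. s \<notin> {{x, y}, {x, z}, {y, z}, {x, u}, {y, u}}"
begin

definition K :: "'a set" where "K = {x, y, z, u}"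

definition F :: "'a set set" where "F = E - {{x, y}, {x, z}, {y, z}, {x, u}, {y, u}}"

lemma outgoing:
  "sy \<in> {e \<in> E. y \<in> e}" "sz \<in> {e \<in> E. z \<in> e}" "sv \<in> {e \<in> E. u \<in> e}" "su \<in> {e \<in> E. u \<in> e}"
  unfolding Ey Ez Eu by simp_all

lemma outgoing_in_F: "sy \<in> F" "sz \<in> F" "sv \<in> F" "su \<in> F"
  using outgoing outer unfolding F_def by simp_all

lemma outgoing_meets_K: "sy \<inter> K \<noteq> {}" "sz \<inter> K \<noteq> {}" "sv \<inter> K \<noteq> {}" "su \<inter> K \<noteq> {}"
  using outgoing unfolding K_def by auto

lemma in_F: "e \<in> E \<Longrightarrow> p \<in> e \<Longrightarrow> p \<notin> K \<Longrightarrow> e \<in> F"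
  unfolding F_def K_def by auto

lemma extend:
  assumes c: "proper_outside F K 4 c" and "c sv \<noteq> c su"
    and nd: "\<not> distinct [c sz, c sy, c sv, c su]"
  shows "\<exists>c. proper_edge_coloring E 4 c"
proof -
  have less: "c sy < 4" "c sz < 4" "c sv < 4" "c su < 4"
    using outgoing_in_F proper_outside_less[OF c] by auto
  obtain xy' xz' yz' xu yu where n: "xy' < 4" "xz' < 4" "yz' < 4" "xu < 4" "yu < 4"
    "distinct [xy', xz', xu]" "distinct [xy', yz', yu, c sy]" "distinct [xz', yz', c sz]"
    "distinct [xu, yu, c sv, c su]"
    using inner_colours[OF less \<open>c sv \<noteq> c su\<close> nd] by blast
  define c' where "c' = c({x, y} := xy', {x, z} := xz', {y, z} := yz', {x, u} := xu, {y, u} := yu)"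
  have inner: "c' {x, y} = xy'" "c' {x, z} = xz'" "c' {y, z} = yz'" "c' {x, u} = xu" "c' {y, u} = yu"
    using dist by (auto simp: c'_def doubleton_eq_iff)
  have cF: "c' e = c e" if "e \<in> F" for e using that by (auto simp: c'_def F_def)
  \<comment> \<open>Properness is checked vertex by vertex: on \<open>K\<close> by the explicit edge
    lists, elsewhere only edges of \<open>F\<close> occur.\<close>
  have at: "inj_on c' {e \<in> E. p \<in> e}" for p
  proof (cases "p \<in> K")
    case True
    then consider "p = x" | "p = y" | "p = z" | "p = u" unfolding K_def by blast
    then show ?thesis
    proof cases
      case 1
      show ?thesis unfolding 1 Ex using n by (auto simp: inj_on_def inner cF outgoing_in_F)
    next
      case 2
      show ?thesis unfolding 2 Ey using n by (auto simp: inj_on_def inner cF outgoing_in_F)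
    next
      case 3
      show ?thesis unfolding 3 Ez using n by (auto simp: inj_on_def inner cF outgoing_in_F)
    next
      case 4
      show ?thesis unfolding 4 Eu using n by (auto simp: inj_on_def inner cF outgoing_in_F)
    qed
  next
    case False
    show ?thesis
    proof (rule inj_onI)
      fix e f assume "e \<in> {e \<in> E. p \<in> e}" "f \<in> {e \<in> E. p \<in> e}" "c' e = c' f"
      then show "e = f"
        using proper_outside_neq[OF c, of e f p] in_F[of _ p] cF False by auto
    qed
  qed
  have "c' e < 4" if "e \<in> E" for e
    using n proper_outside_less[OF c, of e] that by (auto simp: c'_def F_def)
  moreover have "c' e \<noteq> c' f" if "e \<in> E" "f \<in> E" "e \<noteq> f" "e \<inter> f \<noteq> {}" for e f
    using that at by (auto dest: inj_onD)
  ultimately have "proper_edge_coloring E 4 c'" unfolding proper_edge_coloring_def by blast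
  then show ?thesis by blast
qed

section \<open>Kempe swaps starting at \<open>w\<close>\<close>

text \<open>A chain through an outgoing edge would give it the colour of another outgoing edge,
  which is not on the chain, and \<open>extend\<close> would contradict \<open>none\<close>. So the
  swap leaves all outgoing colours alone.\<close>

lemma swap_or_extend:
  assumes c: "proper_outside F K 4 c" and d: "distinct [c sz, c sy, c sv, c su]"
    and none: "\<nexists>c. proper_edge_coloring E 4 c"
    and "w \<notin> K" and w: "\<forall>e\<in>F. w \<in> e \<longrightarrow> c e \<noteq> m"
    and "m < 4" "l < 4" "m \<noteq> l" and ml: "{m, l} \<noteq> {c sv, c su}"
  shows "\<exists>c'. proper_outside F K 4 c' \<and> (\<forall>s\<in>{sz, sy, sv, su}. c' s = c s) \<and>
    (\<forall>e\<in>F. w \<in> e \<longrightarrow> c' e = transpose m l (c e))"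
proof -
  have F: "finite F" "\<forall>e\<in>F. card e = 2" using fin two by (auto simp: F_def)
  obtain T h where T': "proper_outside F K 4 (\<lambda>e. if e \<in> T then transpose m l (c e) else c e)"
      "\<forall>e\<in>T. c e \<in> {m, l} \<and> (e \<inter> K \<noteq> {} \<longrightarrow> e = h)"
    and Tw: "\<forall>e\<in>F. w \<in> e \<and> c e = l \<longrightarrow> e \<in> T"
    using kempe_swap[OF F c \<open>m < 4\<close> \<open>l < 4\<close> \<open>w \<notin> K\<close> w] by (elim exE conjE)
  define c' where "c' = (\<lambda>e. if e \<in> T then transpose m l (c e) else c e)"
  have c': "proper_outside F K 4 c'" using T'(1) by (simp add: c'_def)
  have T: "c e \<in> {m, l}" and h: "e \<inter> K \<noteq> {} \<Longrightarrow> e = h" if "e \<in> T" for e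
    using T'(2) that by auto
  have c'w: "c' e = transpose m l (c e)" if "e \<in> F" "w \<in> e" for e
    using w Tw that by (auto simp: c'_def transpose_def)
  let ?S = "{sz, sy, sv, su}"
  have inj: "inj_on c ?S" using d by (auto simp: inj_on_def)
  \<comment> \<open>All four colours leave \<open>K\<close>, so a swapped outgoing colour always
    meets an equal one.\<close>
  have "c ` ?S = {..<4}"
  proof (rule card_subset_eq)
    show "c ` ?S \<subseteq> {..<4}" using outgoing_in_F proper_outside_less[OF c] by auto
    show "card (c ` ?S) = card {..<4::nat}" using d by simp
  qed simp
  have "s \<notin> T" if s: "s \<in> ?S" for s
  proof
    assume "s \<in> T"
    have others: "r \<notin> T" if "r \<in> ?S" "r \<noteq> s" for r
      using h[of r] h[OF \<open>s \<in> T\<close>] that s outgoing_meets_K by auto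
    have "transpose m l (c s) \<in> c ` ?S"
      using T[OF \<open>s \<in> T\<close>] \<open>m < 4\<close> \<open>l < 4\<close> unfolding \<open>c ` ?S = {..<4}\<close> by auto
    then obtain r where r: "transpose m l (c s) = c r" "r \<in> ?S" by (rule imageE)
    have cs: "c ` {s, r} = {m, l}" using T[OF \<open>s \<in> T\<close>] unfolding image_insert r(1)[symmetric] by auto
    then have "r \<noteq> s" using \<open>m \<noteq> l\<close> by (auto simp: doubleton_eq_iff)
    have c's: "c' s = c r" using \<open>s \<in> T\<close> r(1) by (simp add: c'_def)
    have c'r: "c' q = c q" if "q \<in> ?S" "q \<noteq> s" for q using others[OF that] by (simp add: c'_def)
    have "\<not> inj_on c' ?S"
      using c's c'r[OF r(2) \<open>r \<noteq> s\<close>] \<open>r \<noteq> s\<close> r(2) s by (metis inj_onD)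
    then have "\<not> distinct [c' sz, c' sy, c' sv, c' su]"
      using distinct_map[of c' "[sz, sy, sv, su]"] by simp
    \<comment> \<open>The repetition must not occur at \<open>u\<close>, since \<open>extend\<close>
      needs two colours there; it would force \<open>{m, l}\<close> to be the forbidden
      pair.\<close>
    moreover have "c' sv \<noteq> c' su"
    proof
      assume eq: "c' sv = c' su"
      have "c sv \<noteq> c su" using d by simp
      then have "s = sv \<or> s = su" using eq c'r[of sv] c'r[of su] by (metis insertCI)
      then have "{s, r} = {sv, su}"
      proof
        assume "s = sv"
        then have "c r = c su" using eq c's c'r[of su] \<open>c sv \<noteq> c su\<close> by (metis insertCI)
        then show ?thesis using inj_onD[OF inj, of r su] r(2) \<open>s = sv\<close> by simp
      next
        assume "s = su"
        then have "c r = c sv" using eq c's c'r[of sv] \<open>c sv \<noteq> c su\<close> by (metis insertCI)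
        then show ?thesis using inj_onD[OF inj, of r sv] r(2) \<open>s = su\<close> by auto
      qed
      then show False using cs ml by simp
    qed
    ultimately show False using extend[OF c'] none by blast
  qed
  then have "c' s = c s" if "s \<in> ?S" for s using that by (simp add: c'_def)
  then show ?thesis using c' c'w by (intro exI[of _ c']) simp
qed

lemma coloring_exists:
  assumes c: "proper_outside F K 4 c" and "c sv \<noteq> c su"
    and "v \<in> sv" "w \<notin> sv" "v \<notin> K" "w \<notin> K" and vw: "{v, w} \<in> E" and deg: "degree E w = 3"
  shows "\<exists>c. proper_edge_coloring E 4 c"
proof (rule ccontr)
  assume none: "\<nexists>c. proper_edge_coloring E 4 c"
  have vwF: "{v, w} \<in> F" using in_F[OF vw, of v] \<open>v \<notin> K\<close> by simp
  have d: "distinct [c sz, c sy, c sv, c su]" using extend[OF c \<open>c sv \<noteq> c su\<close>] none by blast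
  obtain i i' p q where iq: "c sv = i" "c su = i'" "c sz = p" "c sy = q" by blast
  have less: "i < 4" "i' < 4" "p < 4" "q < 4"
    using outgoing_in_F proper_outside_less[OF c] iq by auto
  have di: "distinct [i, i', p, q]" using d iq by auto
  have cover: "r \<in> {i, i', p, q}" if "r < 4" for r
  proof -
    have "{i, i', p, q} = {..<4}" by (rule card_subset_eq) (use less di in auto)
    then show ?thesis using that by auto
  qed
  \<comment> \<open>\<open>Q j m\<close>: Kempe swaps away from the four outgoing edges can give \<open>vw\<close> the colour \<open>j\<close> while
    \<open>w\<close> misses \<open>m\<close>. Every state is driven to \<open>Q i _\<close>, where \<open>vw\<close> and \<open>uv\<close> clash at \<open>v\<close>.\<close>
  define Q where "Q j m \<longleftrightarrow> (\<exists>c'. proper_outside F K 4 c' \<and>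
      (\<forall>s\<in>{sz, sy, sv, su}. c' s = c s) \<and> c' {v, w} = j \<and> (\<forall>e\<in>F. w \<in> e \<longrightarrow> c' e \<noteq> m))" for j m
  have not_i: "\<not> Q i m" for m
  proof
    assume "Q i m"
    then obtain c' where "proper_outside F K 4 c'" "c' sv = i" "c' {v, w} = i"
      unfolding Q_def using iq by auto
    then show False
      using proper_outside_neq[of F K 4 c' sv "{v, w}" v] outgoing_in_F vwF \<open>v \<in> sv\<close> \<open>v \<notin> K\<close>
        \<open>w \<notin> sv\<close> by auto
  qed
  \<comment> \<open>Since \<open>w\<close> misses \<open>m\<close>, the swap turns its
    \<open>l\<close>-edge, if any, into an \<open>m\<close>-edge, and \<open>w\<close> then misses
    \<open>l\<close>.\<close>
  have step: "Q (transpose m l j) l"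
    if Q: "Q j m" and ml: "m < 4" "l < 4" "m \<noteq> l" "{m, l} \<noteq> {i, i'}" for j m l
  proof -
    obtain c' where c': "proper_outside F K 4 c'" "\<And>s. s \<in> {sz, sy, sv, su} \<Longrightarrow> c' s = c s"
      "c' {v, w} = j" "\<forall>e\<in>F. w \<in> e \<longrightarrow> c' e \<noteq> m"
      using Q unfolding Q_def by blast
    have d': "distinct [c' sz, c' sy, c' sv, c' su]" "{m, l} \<noteq> {c' sv, c' su}"
      using c'(2) d ml iq by simp_all
    obtain c'' where c'': "proper_outside F K 4 c''" "\<forall>s\<in>{sz, sy, sv, su}. c'' s = c' s"
      "\<forall>e\<in>F. w \<in> e \<longrightarrow> c'' e = transpose m l (c' e)"
      using swap_or_extend[OF c'(1) d'(1) none \<open>w \<notin> K\<close> c'(4) ml(1-3) d'(2)] by (elim exE conjE)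
    have "c'' e \<noteq> l" if "e \<in> F" "w \<in> e" for e
      using c'(4) that c''(3) by (auto simp: transpose_def split: if_splits)
    then show ?thesis
      unfolding Q_def using c'' c'(2,3) vwF by (intro exI[of _ c'']) auto
  qed
  \<comment> \<open>The states are eliminated backwards from the clash, each by one swap into a
    state already excluded. As \<open>i\<close> and \<open>i'\<close> cannot be swapped directly,
    colour \<open>i'\<close> on \<open>vw\<close> is first exchanged for \<open>p\<close> or
    \<open>q\<close>.\<close>
  have pi: "\<not> Q p i" and qi: "\<not> Q q i"
    using step[of p i p] step[of q i q] not_i less di by (auto simp: doubleton_eq_iff)
  then have pq: "\<not> Q p q" and qp: "\<not> Q q p"
    using step[of p q i] step[of q p i] less di by (auto simp: doubleton_eq_iff transpose_def)
  then have pi': "\<not> Q p i'" and qi': "\<not> Q q i'"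
    using step[of p i' q] step[of q i' p] less di by (auto simp: doubleton_eq_iff transpose_def)
  then have i'p: "\<not> Q i' p" and i'q: "\<not> Q i' q"
    using step[of i' p i'] step[of i' q i'] less di by (auto simp: doubleton_eq_iff)
  then have i'i: "\<not> Q i' i"
    using step[of i' i p] less di by (auto simp: doubleton_eq_iff transpose_def)
  \<comment> \<open>The degree of \<open>w\<close> leaves it an initial missing colour
    \<open>m\<close>.\<close>
  have "card (c ` {e \<in> E. w \<in> e}) < card {..<4::nat}"
    using card_image_le[of "{e \<in> E. w \<in> e}" c] fin deg by (simp add: degree_def)
  then have "\<not> {..<4} \<subseteq> c ` {e \<in> E. w \<in> e}"
    using card_mono[of "c ` {e \<in> E. w \<in> e}" "{..<4}"] fin by force
  then obtain m where m: "m < 4" "\<And>e. e \<in> E \<Longrightarrow> w \<in> e \<Longrightarrow> c e \<noteq> m" by auto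
  then have "Q (c {v, w}) m" "c {v, w} \<noteq> m"
    using c vw unfolding Q_def F_def by auto
  moreover have "c {v, w} < 4" using vwF proper_outside_less[OF c] by blast
  ultimately show False
    using cover[OF m(1)] cover[of "c {v, w}"] not_i pi qi pq qp pi' qi' i'p i'q i'i by auto
qed

end

section \<open>Reading the configuration off the degrees\<close>

lemma ex_insert_of_card_Suc:
  assumes "B \<subseteq> A" and "card A = Suc (card B)"
  shows "\<exists>s. s \<notin> B \<and> A = insert s B"
proof -
  have "finite A" using assms(2) card.infinite by fastforce
  then have "card (A - B) = 1" using assms by (simp add: card_Diff_subset finite_subset)
  then obtain s where "A - B = {s}" by (auto simp: card_1_singleton_iff)
  then show ?thesis using assms(1) by blast
qed

theorem proposition2p13:
  fixes V :: "'a set" and E :: "'a set set" and x y z u v w :: 'a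
  assumes "finite_simple_graph V E" and "connected_graph V E"
    and "max_degree V E = 4"
    and "{x, y, z, u, v, w} \<subseteq> V" and "distinct [x, y, z, u, v, w]"
    and "{x, y} \<in> E" and "{x, z} \<in> E" and "{y, z} \<in> E" and "{x, u} \<in> E"
    and "{y, u} \<in> E" and "{u, v} \<in> E" and "{v, w} \<in> E"
    and "degree E x = 3" and "degree E z = 3" and "degree E w = 3"
    and "degree E y = 4" and "degree E u = 4" and "degree E v = 4"
    and "chromatic_index (E - {{x, y}}) = 4"
  shows "chromatic_index E = 4"
proof -
  note d = \<open>distinct [x, y, z, u, v, w]\<close>
  note edges = assms(6-12)
  have two: "\<And>e. e \<in> E \<Longrightarrow> card e = 2" and "E \<subseteq> Pow V" and "finite V"
    using assms(1) by (auto simp: finite_simple_graph_def)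
  then have fin: "finite E" using finite_subset by blast
  have Ex: "{e \<in> E. x \<in> e} = {{x, y}, {x, z}, {x, u}}"
  proof (rule card_subset_eq[symmetric])
    show "{{x, y}, {x, z}, {x, u}} \<subseteq> {e \<in> E. x \<in> e}" using edges by auto
    show "card {{x, y}, {x, z}, {x, u}} = card {e \<in> E. x \<in> e}"
      using \<open>degree E x = 3\<close> d by (simp add: degree_def doubleton_eq_iff)
  qed (use fin in simp)
  \<comment> \<open>At each of \<open>y\<close>, \<open>z\<close>, \<open>u\<close> the degree
    exceeds the number of listed edges by one, which gives \<open>sy\<close>, \<open>sz\<close>,
    \<open>su\<close>.\<close>
  have sub_y: "{{x, y}, {y, z}, {y, u}} \<subseteq> {e \<in> E. y \<in> e}" using edges by simp
  have card_y: "card {e \<in> E. y \<in> e} = Suc (card {{x, y}, {y, z}, {y, u}})"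
    using \<open>degree E y = 4\<close> d by (simp add: degree_def doubleton_eq_iff)
  obtain sy where sy: "sy \<notin> {{x, y}, {y, z}, {y, u}}"
    "{e \<in> E. y \<in> e} = insert sy {{x, y}, {y, z}, {y, u}}"
    using ex_insert_of_card_Suc[OF sub_y card_y] by (elim exE conjE)
  have sub_z: "{{x, z}, {y, z}} \<subseteq> {e \<in> E. z \<in> e}" using edges by simp
  have card_z: "card {e \<in> E. z \<in> e} = Suc (card {{x, z}, {y, z}})"
    using \<open>degree E z = 3\<close> d by (simp add: degree_def doubleton_eq_iff)
  obtain sz where sz: "sz \<notin> {{x, z}, {y, z}}"
    "{e \<in> E. z \<in> e} = insert sz {{x, z}, {y, z}}"
    using ex_insert_of_card_Suc[OF sub_z card_z] by (elim exE conjE)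
  have sub_u: "{{x, u}, {y, u}, {u, v}} \<subseteq> {e \<in> E. u \<in> e}" using edges by simp
  have card_u: "card {e \<in> E. u \<in> e} = Suc (card {{x, u}, {y, u}, {u, v}})"
    using \<open>degree E u = 4\<close> d by (simp add: degree_def doubleton_eq_iff)
  obtain su where su: "su \<notin> {{x, u}, {y, u}, {u, v}}"
    "{e \<in> E. u \<in> e} = insert su {{x, u}, {y, u}, {u, v}}"
    using ex_insert_of_card_Suc[OF sub_u card_u] by (elim exE conjE)
  have "sy \<in> {e \<in> E. y \<in> e}" "sz \<in> {e \<in> E. z \<in> e}" "su \<in> {e \<in> E. u \<in> e}"
    unfolding sy(2) sz(2) su(2) by simp_all
  then have "y \<in> sy" "z \<in> sz" "su \<in> E" "u \<in> su" by simp_all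
  interpret triangle_pair E x y z u sy sz "{u, v}" su
  proof
    show "\<forall>s\<in>{sy, sz, {u, v}, su}. s \<notin> {{x, y}, {x, z}, {y, z}, {x, u}, {y, u}}"
    proof -
      have "sy \<noteq> {x, z}" "sy \<noteq> {x, u}" using \<open>y \<in> sy\<close> d by auto
      moreover have "sz \<noteq> {x, y}" "sz \<noteq> {x, u}" "sz \<noteq> {y, u}" using \<open>z \<in> sz\<close> d by auto
      moreover have "su \<noteq> {x, y}" "su \<noteq> {x, z}" "su \<noteq> {y, z}" using \<open>u \<in> su\<close> d by auto
      moreover have "{u, v} \<notin> {{x, y}, {x, z}, {y, z}, {x, u}, {y, u}}"
        using d by (auto simp: doubleton_eq_iff)
      ultimately show ?thesis using sy(1) sz(1) su(1) by simp
    qed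
    show "{e \<in> E. y \<in> e} = {{x, y}, {y, z}, {y, u}, sy}" unfolding sy(2) by (simp add: insert_commute)
    show "{e \<in> E. z \<in> e} = {{x, z}, {y, z}, sz}" unfolding sz(2) by (simp add: insert_commute)
    show "{e \<in> E. u \<in> e} = {{x, u}, {y, u}, {u, v}, su}"
      unfolding su(2) by (simp add: insert_commute)
    show "distinct [x, y, z, u]" using d by simp
  qed (fact fin two Ex)+
  obtain c where c: "proper_edge_coloring (E - {{x, y}}) 4 c"
    using chromatic_index_attained[of "E - {{x, y}}"] fin assms(19) by force
  \<comment> \<open>Only the colours on \<open>F\<close> are used from here on; properness at
    \<open>u\<close> survives as the inequality for \<open>{u, v}\<close> and
    \<open>su\<close>.\<close>
  have "F \<subseteq> E - {{x, y}}" by (auto simp: F_def)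
  then have "proper_outside F K 4 c"
    by (rule proper_outside_if_proper[OF proper_edge_coloring_subset[OF c]])
  moreover have "c {u, v} \<noteq> c su"
  proof -
    have "{u, v} \<noteq> {x, y}" "su \<noteq> {x, y}" using \<open>u \<in> su\<close> d by (auto simp: doubleton_eq_iff)
    then have "{u, v} \<in> E - {{x, y}}" "su \<in> E - {{x, y}}" using edges \<open>su \<in> E\<close> by simp_all
    moreover have "{u, v} \<noteq> su" "{u, v} \<inter> su \<noteq> {}" using su(1) \<open>u \<in> su\<close> by auto
    ultimately show ?thesis by (rule proper_edge_coloring_neq[OF c])
  qed
  moreover have "v \<notin> K" "w \<notin> K" "w \<notin> {u, v}" using d by (auto simp: K_def)
  ultimately have "\<exists>c. proper_edge_coloring E 4 c"
    using coloring_exists[of c v w] \<open>{v, w} \<in> E\<close> \<open>degree E w = 3\<close> by blast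
  then have "chromatic_index E \<le> 4" unfolding chromatic_index_def by (rule Least_le)
  \<comment> \<open>The lower bound comes from monotonicity: a colouring of \<open>E\<close>
    restricts to \<open>E - {{x, y}}\<close>.\<close>
  moreover have "4 \<le> chromatic_index E"
  proof -
    obtain c where "proper_edge_coloring E (chromatic_index E) c"
      using chromatic_index_attained[OF fin] ..
    then have "proper_edge_coloring (E - {{x, y}}) (chromatic_index E) c"
      by (rule proper_edge_coloring_subset) simp
    then have "\<exists>c. proper_edge_coloring (E - {{x, y}}) (chromatic_index E) c"
      by (intro exI[of _ c])
    then have "chromatic_index (E - {{x, y}}) \<le> chromatic_index E"
      unfolding chromatic_index_def[of "E - {{x, y}}"] by (rule Least_le)
    then show ?thesis using assms(19) by simp
  qed
  ultimately show ?thesis by simp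
qed

end
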